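(* Let $f,g$ be meromorphic modular forms of weights $k,l\in\mathbb Z$ respectively, let $n$ be a positive integer, and suppose $k+l\ge2$ or $k+l+2n\le0$. Then for every $0\le i\le n$, $$D^{n-i}[f,g]_i=\sum_{j=0}^nc_{i,j}^{k,l,n}(D^{n-j}f)(D^jg)\quad\text{and}\quad (D^{n-i}f)(D^ig)=\sum_{j=0}^nb_{i,j}^{k,l,n}D^{n-j}[f,g]_j,$$ where $$c_{i,j}^{k,l,n}=\sum_{r=0}^i(-1)^r\binom{n-i}{n-j-r}\binom{k+i-1}{i-r}\binom{l+i-1}{r},$$ $$b_{i,j}^{k,l,n}=\frac{\binom{n}{j}\sum_{r=0}^j(-1)^r\binom{j}{r}\binom{k+n-i-1}{n-i-r}\binom{l+i-1}{r+i-j}}{\binom{n}{i}\binom{k+l+n+j-1}{n-j}\binom{k+l+2j-2}{j}}.$$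
   Context: $\mathcal H$ is the upper half-plane, $q=e^{2\pi i\tau}$. A meromorphic modular form of weight $k$ is a meromorphic $f$ on $\mathcal H$ with $(c\tau+d)^{-k}f(\frac{a\tau+b}{c\tau+d})=f(\tau)$ for all $\begin{pmatrix}a&b\\c&d\end{pmatrix}\in SL_2(\mathbb Z)$ and meromorphic at infinity. $D=\frac{1}{2\pi i}\frac{d}{d\tau}$. The $m$-th Rankin--Cohen bracket is $[f,g]_m=\sum_{j=0}^m(-1)^j\binom{m+k-1}{j}\binom{m+l-1}{m-j}D^{m-j}f\,D^jg$. Binomial coefficients are $\binom{x}{r}=x(x-1)\cdots(x-r+1)/r!$ for integers $r\ge0$ and any integer $x$, and $\binom{x}{r}=0$ for $r<0$.
   Formalization: With the bracket as defined, the stated identities fail by a sign (for n=i=1 the right side of the first is −[f,g]_1, e.g. f=E_4, g=E_6); each [f,g]_m is therefore replaced by (−1)^m[f,g]_m in both identities, with c and b unchanged. *)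

theory Defs
  imports "HOL-Complex_Analysis.Complex_Analysis"
begin

definition upper_half_plane :: "complex set" where
  "upper_half_plane = {\<tau>. Im \<tau> > 0}"

text \<open>
  A meromorphic function is represented by its normalised representative: removable
  singularities are filled in and the value at a pole is 0.  The transformation law, read
  pointwise, then also says that poles are mapped to poles.  Meromorphy at infinity means
  that \<open>f\<close>, as a function of \<open>q = exp (2 \<pi> i \<tau>)\<close>, is meromorphic at \<open>q = 0\<close>; the value
  of \<open>F\<close> at 0 plays no role.
\<close>

definition meromorphic_modular_form :: "int \<Rightarrow> (complex \<Rightarrow> complex) \<Rightarrow> bool" where
  "meromorphic_modular_form k f \<longleftrightarrow>
     f nicely_meromorphic_on upper_half_plane \<and>
     (\<forall>a b c d :: int. a * d - b * c = 1 \<longrightarrow>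
        (\<forall>\<tau>\<in>upper_half_plane.
           (of_int c * \<tau> + of_int d) powi (- k) *
             f ((of_int a * \<tau> + of_int b) / (of_int c * \<tau> + of_int d)) = f \<tau>)) \<and>
     (\<exists>F. F meromorphic_on {0} \<and>
        (\<forall>\<tau>\<in>upper_half_plane. f \<tau> = F (exp (2 * of_real pi * \<i> * \<tau>))))"

text \<open>
  The derivation \<open>D\<close>.  At a pole of \<open>f\<close> the value of \<open>deriv f\<close> is unspecified; identities
  between such derivatives are meant away from the poles.
\<close>

definition D :: "(complex \<Rightarrow> complex) \<Rightarrow> complex \<Rightarrow> complex" where
  "D f = (\<lambda>\<tau>. 1 / (2 * of_real pi * \<i>) * deriv f \<tau>)"

text \<open>Binomial coefficients with integer entries, zero for a negative lower entry.\<close>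

definition zbinom :: "int \<Rightarrow> int \<Rightarrow> complex" where
  "zbinom x r = (if r < 0 then 0 else of_int x gchoose nat r)"

definition rankin_cohen ::
    "int \<Rightarrow> int \<Rightarrow> nat \<Rightarrow> (complex \<Rightarrow> complex) \<Rightarrow> (complex \<Rightarrow> complex) \<Rightarrow> complex \<Rightarrow> complex" where
  "rankin_cohen k l m f g = (\<lambda>\<tau>. \<Sum>j=0..m.
     (- 1) ^ j * zbinom (int m + k - 1) (int j) * zbinom (int m + l - 1) (int m - int j) *
     (D ^^ (m - j)) f \<tau> * (D ^^ j) g \<tau>)"

text \<open>
  The coefficients below belong to the opposite sign normalisation \<open>(-1)^m [f,g]\<^sub>m\<close> of
  the bracket.  For instance \<open>[f,g]\<^sub>1 = l f' g - k f g'\<close> in the normalisation above (with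
  \<open>f' = D f\<close>), whereas \<open>c\<^sub>1\<^sub>,\<^sub>0 = -l\<close> and \<open>c\<^sub>1\<^sub>,\<^sub>1 = k\<close> for \<open>n = 1\<close>.  Identities relating
  the two therefore carry a sign \<open>(-1)^m\<close> next to every \<open>[f,g]\<^sub>m\<close>.
\<close>

definition c_coeff :: "int \<Rightarrow> int \<Rightarrow> nat \<Rightarrow> nat \<Rightarrow> nat \<Rightarrow> complex" where
  "c_coeff k l n i j = (\<Sum>r=0..i.
     (- 1) ^ r * zbinom (int n - int i) (int n - int j - int r) *
     zbinom (k + int i - 1) (int i - int r) * zbinom (l + int i - 1) (int r))"

definition b_coeff :: "int \<Rightarrow> int \<Rightarrow> nat \<Rightarrow> nat \<Rightarrow> nat \<Rightarrow> complex" where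
  "b_coeff k l n i j =
     (zbinom (int n) (int j) * (\<Sum>r=0..j.
        (- 1) ^ r * zbinom (int j) (int r) *
        zbinom (k + int n - int i - 1) (int n - int i - int r) *
        zbinom (l + int i - 1) (int r + int i - int j))) /
     (zbinom (int n) (int i) * zbinom (k + l + int n + int j - 1) (int n - int j) *
      zbinom (k + l + 2 * int j - 2) (int j))"

end

theory Submission
  imports Defs "Jordan_Normal_Form.Determinant"
begin

text \<open>
  Replacing \<open>D\<^sup>a f \<cdot> D\<^sup>b g\<close> by \<open>X\<^sup>a Y\<^sup>b\<close> turns \<open>D\<close> into multiplication by \<open>X + Y\<close> and, up to sign,
  \<open>[f,g]\<^sub>i\<close> into a Jacobi polynomial \<open>P\<^sub>i\<close>, so the claim is that the matrices \<open>c\<close> and \<open>b\<close> are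
  mutually inverse.  The Beta integrals against the weight \<open>t\<^sup>k\<^sup>-\<^sup>1 (1 - t)\<^sup>l\<^sup>-\<^sup>1\<close>, for which the
  \<open>P\<^sub>i\<close> are orthogonal, suggest the linear functional
  \<open>M\<^sub>j (X\<^sup>a Y\<^sup>b) = (\<Sum>r\<le>j. (-1)\<^sup>r (j choose r) (k + r)\<^sub>a (l + j - r)\<^sub>b)\<close> with rising factorials, which
  is the pairing with \<open>P\<^sub>j\<close> up to factors that may vanish for nonpositive weights.
  It satisfies \<open>M\<^sub>j ((X + Y) p) = (k + l + j + deg p) M\<^sub>j p\<close>, it kills \<open>P\<^sub>i\<close> for \<open>i \<noteq> j\<close>, and
  \<open>b\<close> consists of its values on monomials, divided by its value at \<open>(X + Y)\<^sup>n\<^sup>-\<^sup>j P\<^sub>j\<close>.  Hence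
  \<open>c b = 1\<close>; the hypothesis on \<open>k + l\<close> makes the denominators nonzero.
\<close>

section \<open>The functional M_j as an iterated difference of products of rising factorials\<close>

definition diff_poch :: "'a::field_char_0 \<Rightarrow> 'a \<Rightarrow> nat \<Rightarrow> nat \<Rightarrow> nat \<Rightarrow> 'a" where
  "diff_poch x y j a b = (\<Sum>r\<le>j. (-1) ^ r * of_nat (j choose r) *
     pochhammer (x + of_nat r) a * pochhammer (y + of_nat (j - r)) b)"

text \<open>Pascal's rule under a sum. It is the induction step both for the differences below and
  for the Leibniz rule of \<open>D\<close>.\<close>

lemma sum_binomial_Suc:
  fixes F :: "nat \<Rightarrow> 'a::comm_semiring_1"
  shows "(\<Sum>r\<le>Suc j. of_nat (Suc j choose r) * F r) =
         (\<Sum>r\<le>j. of_nat (j choose r) * F r) + (\<Sum>r\<le>j. of_nat (j choose r) * F (Suc r))"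
proof -
  have "(\<Sum>r\<le>Suc j. of_nat (Suc j choose r) * F r) =
        F 0 + (\<Sum>r\<le>j. of_nat (Suc j choose Suc r) * F (Suc r))"
    by (simp only: sum.atMost_Suc_shift) simp
  also have "\<dots> = (F 0 + (\<Sum>r\<le>j. of_nat (j choose Suc r) * F (Suc r)))
                 + (\<Sum>r\<le>j. of_nat (j choose r) * F (Suc r))"
    by (simp add: sum.distrib algebra_simps)
  also have "F 0 + (\<Sum>r\<le>j. of_nat (j choose Suc r) * F (Suc r)) =
             (\<Sum>r\<le>Suc j. of_nat (j choose r) * F r)"
    by (simp only: sum.atMost_Suc_shift) simp
  finally show ?thesis by (simp add: binomial_eq_0)
qed

text \<open>Rising factorials play the role of powers for the forward difference: both terms share
  the factor \<open>pochhammer (y + 1) (b - 1)\<close>. At \<open>b = 0\<close> the truncated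
  subtraction is harmless, since its coefficient vanishes.\<close>

lemma pochhammer_diff:
  fixes y :: "'a::comm_ring_1"
  shows "pochhammer (y + 1) b - pochhammer y b = of_nat b * pochhammer (y + 1) (b - 1)"
proof (cases b)
  case (Suc m)
  have "pochhammer (y + 1) b = (y + 1 + of_nat m) * pochhammer (y + 1) m"
    and "pochhammer y b = y * pochhammer (y + 1) m"
    unfolding Suc by (rule pochhammer_rec', rule pochhammer_rec)
  then show ?thesis by (simp add: Suc algebra_simps)
qed simp

text \<open>With the unit shifts E_x and E_y, the definition is the binomial expansion of (E_y -
  E_x)^j; one factor is split off here.\<close>

lemma diff_poch_Suc:
  "diff_poch x y (Suc j) a b = diff_poch x (y + 1) j a b - diff_poch (x + 1) y j a b"
proof -
  define F where "F r = (-1) ^ r * pochhammer (x + of_nat r) a * pochhammer (y + of_nat (Suc j - r)) b" for r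
  have "diff_poch x y (Suc j) a b = (\<Sum>r\<le>Suc j. of_nat (Suc j choose r) * F r)"
    unfolding diff_poch_def F_def by (intro sum.cong) (auto simp: mult_ac)
  also have "\<dots> = (\<Sum>r\<le>j. of_nat (j choose r) * F r) + (\<Sum>r\<le>j. of_nat (j choose r) * F (Suc r))"
    by (rule sum_binomial_Suc)
  also have "(\<Sum>r\<le>j. of_nat (j choose r) * F r) = diff_poch x (y + 1) j a b"
    unfolding diff_poch_def F_def by (intro sum.cong) (auto simp: Suc_diff_le algebra_simps)
  also have "(\<Sum>r\<le>j. of_nat (j choose r) * F (Suc r)) = - diff_poch (x + 1) y j a b"
    unfolding diff_poch_def F_def sum_negf[symmetric] by (intro sum.cong) (auto simp: algebra_simps)
  finally show ?thesis by simp
qed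

lemma diff_poch_shift_left:
  "diff_poch (x + 1) y j a b - diff_poch x y j a b = of_nat a * diff_poch (x + 1) y j (a - 1) b"
proof -
  have "pochhammer (x + 1 + of_nat r) a =
        pochhammer (x + of_nat r) a + of_nat a * pochhammer (x + 1 + of_nat r) (a - 1)" for r
    using pochhammer_diff[of "x + of_nat r" a] by (simp add: algebra_simps)
  then show ?thesis
    unfolding diff_poch_def sum_distrib_left sum_subtractf[symmetric]
    by (intro sum.cong refl) (simp add: algebra_simps)
qed

lemma diff_poch_shift_right:
  "diff_poch x (y + 1) j a b - diff_poch x y j a b = of_nat b * diff_poch x (y + 1) j a (b - 1)"
proof -
  have "pochhammer (y + 1 + of_nat r) b =
        pochhammer (y + of_nat r) b + of_nat b * pochhammer (y + 1 + of_nat r) (b - 1)" for r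
    using pochhammer_diff[of "y + of_nat r" b] by (simp add: algebra_simps)
  then show ?thesis
    unfolding diff_poch_def sum_distrib_left sum_subtractf[symmetric]
    by (intro sum.cong refl) (simp add: algebra_simps del: of_nat_diff)
qed

text \<open>
  With \<open>\<Delta>\<^sub>x, \<Delta>\<^sub>y\<close> the forward differences, \<open>diff_poch x y j a b\<close> is \<open>(\<Delta>\<^sub>y - \<Delta>\<^sub>x)\<^sup>j\<close> applied to
  \<open>(x)\<^sub>a (y)\<^sub>b\<close>; the right-hand side is the binomial expansion of that operator.
\<close>

lemma diff_poch_leibniz:
  "diff_poch x y j a b = fact j * (\<Sum>r\<le>j. (-1) ^ r * of_nat (a choose r) * of_nat (b choose (j - r)) *
     pochhammer (x + of_nat r) (a - r) * pochhammer (y + of_nat (j - r)) (b - (j - r)))"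
proof (induction j arbitrary: x y a b)
  case 0
  show ?case by (simp add: diff_poch_def)
next
  case (Suc j)
  define T where "T x y a b j r = (-1) ^ r * of_nat (a choose r) * of_nat (b choose (j - r)) *
     pochhammer (x + of_nat r) (a - r) * pochhammer (y + of_nat (j - r)) (b - (j - r))"
    for x y :: 'a and a b j r
  \<comment> \<open>The weight j + 1 of each term is split as (j + 1 - r) + r. Absorbing each weight
    into a binomial coefficient turns the two parts into the sums coming from the difference in
    \<open>y\<close> (\<open>A\<close>) and the difference in \<open>x\<close>
    (\<open>B\<close>).\<close>
  have A: "(\<Sum>r\<le>Suc j. of_nat (Suc j - r) * T x y a b (Suc j) r) =
           of_nat b * (\<Sum>r\<le>j. T x (y + 1) a (b - 1) j r)"
  proof -
    have "of_nat (Suc j - r) * T x y a b (Suc j) r = of_nat b * T x (y + 1) a (b - 1) j r"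
      if "r \<le> j" for r
    proof (cases b)
      case 0
      with that show ?thesis by (simp add: T_def Suc_diff_le)
    next
      case (Suc b')
      have absorb: "of_nat (Suc (j - r)) * of_nat (Suc b' choose Suc (j - r)) =
            (of_nat (Suc b') * of_nat (b' choose (j - r)) :: 'a)"
        unfolding of_nat_mult[symmetric] by (simp only: Suc_times_binomial)
      define W where "W = (-1) ^ r * of_nat (a choose r) * pochhammer (x + of_nat r) (a - r) *
        pochhammer (y + 1 + of_nat (j - r)) (b' - (j - r))"
      have shift: "y + of_nat (Suc (j - r)) = y + 1 + of_nat (j - r)" by (simp add: add.assoc)
      have "of_nat (Suc j - r) * T x y a b (Suc j) r =
          W * (of_nat (Suc (j - r)) * of_nat (Suc b' choose Suc (j - r)))"
        by (simp only: T_def W_def Suc Suc_diff_le[OF that] shift diff_Suc_Suc mult_ac)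
      also have "\<dots> = of_nat b * T x (y + 1) a (b - 1) j r"
        unfolding absorb by (simp only: T_def W_def Suc diff_Suc_1 mult_ac)
      finally show ?thesis .
    qed
    then show ?thesis by (simp add: sum_distrib_left)
  qed
  have B: "(\<Sum>r\<le>Suc j. of_nat r * T x y a b (Suc j) r) =
           - of_nat a * (\<Sum>r\<le>j. T (x + 1) y (a - 1) b j r)"
  proof -
    have "of_nat (Suc r) * T x y a b (Suc j) (Suc r) = - of_nat a * T (x + 1) y (a - 1) b j r"
      if "r \<le> j" for r
    proof (cases a)
      case 0
      with that show ?thesis by (simp add: T_def)
    next
      case (Suc a')
      have absorb: "of_nat (Suc r) * of_nat (Suc a' choose Suc r) =
            (of_nat (Suc a') * of_nat (a' choose r) :: 'a)"
        unfolding of_nat_mult[symmetric] by (simp only: Suc_times_binomial)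
      define W where "W = - ((-1) ^ r * of_nat (b choose (j - r)) *
        pochhammer (x + 1 + of_nat r) (a' - r) * pochhammer (y + of_nat (j - r)) (b - (j - r)))"
      have shift: "x + of_nat (Suc r) = x + 1 + of_nat r" by (simp add: add.assoc)
      have "of_nat (Suc r) * T x y a b (Suc j) (Suc r) =
          W * (of_nat (Suc r) * of_nat (Suc a' choose Suc r))"
        by (simp only: T_def W_def Suc shift diff_Suc_Suc power_Suc mult_minus_left mult_1_left
          mult_minus_right mult_ac)
      also have "\<dots> = - of_nat a * T (x + 1) y (a - 1) b j r"
        unfolding absorb
        by (simp only: T_def W_def Suc diff_Suc_1 mult_minus_left mult_minus_right mult_ac)
      finally show ?thesis .
    qed
    then show ?thesis by (simp only: sum.atMost_Suc_shift sum_distrib_left) simp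
  qed
  have IH: "diff_poch x y j a b = fact j * (\<Sum>r\<le>j. T x y a b j r)" for x y a b
    unfolding T_def by (rule Suc.IH)
  \<comment> \<open>E_y - E_x is also the difference of the two forward differences, because the
    unshifted value cancels.\<close>
  have "diff_poch x y (Suc j) a b =
      of_nat b * diff_poch x (y + 1) j a (b - 1) - of_nat a * diff_poch (x + 1) y j (a - 1) b"
    using diff_poch_shift_left[of x y j a b] diff_poch_shift_right[of x y j a b]
    by (simp add: diff_poch_Suc algebra_simps)
  also have "\<dots> = fact j * ((\<Sum>r\<le>Suc j. of_nat (Suc j - r) * T x y a b (Suc j) r)
                          + (\<Sum>r\<le>Suc j. of_nat r * T x y a b (Suc j) r))"
    unfolding A B IH by (simp add: algebra_simps)
  also have "\<dots> = fact j * (\<Sum>r\<le>Suc j. of_nat (Suc j) * T x y a b (Suc j) r)"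
    unfolding sum.distrib[symmetric] distrib_right[symmetric] of_nat_add[symmetric]
    by (intro arg_cong2[where f = "(*)"] sum.cong refl) (auto simp del: of_nat_Suc of_nat_add)
  also have "\<dots> = fact (Suc j) * (\<Sum>r\<le>Suc j. T x y a b (Suc j) r)"
    by (simp only: sum_distrib_left[symmetric] fact_Suc) (simp only: mult_ac)
  finally show ?case unfolding T_def .
qed

text \<open>In the Leibniz expansion every term has \<open>r > a\<close> or
  \<open>j - r > b\<close>: differences of order \<open>j\<close> kill lower total degree.\<close>

lemma diff_poch_eq_0: "a + b < j \<Longrightarrow> diff_poch x y j a b = 0"
  unfolding diff_poch_leibniz mult_eq_0_iff
  by (intro disjI2 sum.neutral ballI) (auto simp: binomial_eq_0_iff)

lemma diff_poch_top: "diff_poch x y (a + b) a b = (-1) ^ a * fact (a + b)"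
proof -
  \<comment> \<open>Only \<open>r = a\<close> leaves both binomial coefficients nonzero.\<close>
  have "(\<Sum>r\<le>a + b. (-1) ^ r * of_nat (a choose r) * of_nat (b choose (a + b - r)) *
     pochhammer (x + of_nat r) (a - r) * pochhammer (y + of_nat (a + b - r)) (b - (a + b - r))) =
     (\<Sum>r\<in>{a}. (-1) ^ r * of_nat (a choose r) * of_nat (b choose (a + b - r)) *
     pochhammer (x + of_nat r) (a - r) * pochhammer (y + of_nat (a + b - r)) (b - (a + b - r)))"
    by (rule sum.mono_neutral_right) (auto simp: not_less_iff_gr_or_eq)
  then show ?thesis unfolding diff_poch_leibniz by simp
qed

text \<open>On homogeneous arguments, multiplication by (X + Y)^N only scales M_j. After splitting
  each rising factorial, the inner sum is Vandermonde's, and its parameters x + r + a and y + j - r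
  + b have a sum independent of r.\<close>

lemma diff_poch_binomial_sum:
  "(\<Sum>t\<le>N. of_nat (N choose t) * diff_poch x y j (a + t) (b + (N - t))) =
   pochhammer (x + y + of_nat (j + a + b)) N * diff_poch x y j a b"
proof -
  have "(\<Sum>t\<le>N. of_nat (N choose t) * diff_poch x y j (a + t) (b + (N - t))) =
    (\<Sum>r\<le>j. (-1) ^ r * of_nat (j choose r) * pochhammer (x + of_nat r) a * pochhammer (y + of_nat (j - r)) b *
      (\<Sum>t\<le>N. of_nat (N choose t) * pochhammer (x + of_nat r + of_nat a) t *
           pochhammer (y + of_nat (j - r) + of_nat b) (N - t)))"
    unfolding diff_poch_def sum_distrib_left
    by (subst sum.swap) (simp add: pochhammer_product' mult_ac del: of_nat_diff add_diff_assoc)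
  also have "\<dots> = (\<Sum>r\<le>j. (-1) ^ r * of_nat (j choose r) * pochhammer (x + of_nat r) a * pochhammer (y + of_nat (j - r)) b *
      pochhammer (x + y + of_nat (j + a + b)) N)"
    unfolding pochhammer_binomial_sum[symmetric]
    by (intro sum.cong refl) (simp add: of_nat_diff algebra_simps)
  finally show ?thesis by (simp add: diff_poch_def sum_distrib_left mult_ac)
qed

section \<open>Orthogonality of the polynomials P_i with respect to M_j\<close>

text \<open>For \<open>r \<le> s\<close>, splitting the two products that start at
  \<open>x + r\<close> at the point \<open>x + s\<close> gives the same three factors on both sides.
  This is the source of the symmetry between i and j in the pairing.\<close>

lemma pochhammer_exchange:
  assumes "r \<le> i" "s \<le> i"
  shows "pochhammer (x + of_nat s) (i - s) * pochhammer (x + of_nat r) s =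
         pochhammer (x + of_nat r) (i - r) * pochhammer (x + of_nat s :: 'a::comm_ring_1) r"
  using assms
proof (induction r s rule: linorder_wlog)
  case (le r s)
  then show ?case
    using pochhammer_product[of "s - r" s "x + of_nat r"] pochhammer_product[of "s - r" "i - r" "x + of_nat r"]
    by (simp add: of_nat_diff algebra_simps)
next
  case (sym r s)
  then show ?case by metis
qed

text \<open>The coefficient of X^r Y^(i-r) in P_i without its sign (-1)^r. Here \<open>r\<close>
  counts derivatives of the first function, whereas the bracket is summed over those of the
  second.\<close>

definition bracket_coeff :: "'a::field_char_0 \<Rightarrow> 'a \<Rightarrow> nat \<Rightarrow> nat \<Rightarrow> 'a" where
  "bracket_coeff x y i r = ((x + of_nat i - 1) gchoose (i - r)) * ((y + of_nat i - 1) gchoose r)"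

lemma bracket_coeff_pochhammer:
  assumes "r \<le> i"
  shows "fact i * bracket_coeff x y i r = of_nat (i choose r) * pochhammer (x + of_nat r) (i - r)
     * pochhammer (y + of_nat (i - r)) r"
  using assms unfolding bracket_coeff_def gbinomial_pochhammer'
  by (simp add: of_nat_diff binomial_fact field_simps)

text \<open>Degree and order agree, so M_j is (-1)^r j! on each monomial; the signs cancel and
  Vandermonde's identity remains.\<close>

lemma bracket_coeff_diff_poch_diag:
  "(\<Sum>r\<le>j. (-1) ^ r * bracket_coeff x y j r * diff_poch x y j r (j - r)) =
   fact j * ((x + y + of_nat (2 * j) - 2) gchoose j)"
proof -
  have "(\<Sum>r\<le>j. (-1) ^ r * bracket_coeff x y j r * diff_poch x y j r (j - r)) = (\<Sum>r\<le>j. fact j * bracket_coeff x y j r)"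
  proof (rule sum.cong)
    fix r assume "r \<in> {..j}"
    then show "(-1) ^ r * bracket_coeff x y j r * diff_poch x y j r (j - r) = fact j * bracket_coeff x y j r"
      using diff_poch_top[of x y r "j - r"] by (simp flip: power_add add: mult_ac)
  qed simp
  also have "\<dots> = fact j * (\<Sum>r\<le>j. ((y + of_nat j - 1) gchoose r) * ((x + of_nat j - 1) gchoose (j - r)))"
    by (simp add: bracket_coeff_def sum_distrib_left mult_ac)
  also have "\<dots> = fact j * ((x + y + of_nat (2 * j) - 2) gchoose j)"
  proof -
    have "y + of_nat j - 1 + (x + of_nat j - 1) = x + y + of_nat (2 * j) - 2" by simp
    then show ?thesis unfolding atLeast0AtMost[symmetric] gbinomial_Vandermonde by (simp only:)
  qed
  finally show ?thesis .
qed

lemma bracket_coeff_diff_poch_off_diag: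
  assumes "i \<noteq> j"
  shows "(\<Sum>r\<le>i. (-1) ^ r * bracket_coeff x y i r * diff_poch x y j r (i - r)) = 0"
proof (cases "i < j")
  case True
  then show ?thesis by (intro sum.neutral) (auto simp: diff_poch_eq_0)
next
  case False
  with assms have "j < i" by simp
  txt \<open>Exchanging the roles of \<open>i\<close> and \<open>j\<close> leaves \<open>i\<close>-th differences of terms of degree \<open>j < i\<close>.\<close>
  have "fact i * (\<Sum>s\<le>i. (-1) ^ s * bracket_coeff x y i s * diff_poch x y j s (i - s)) =
    (\<Sum>s\<le>i. \<Sum>r\<le>j. (-1) ^ s * (fact i * bracket_coeff x y i s) * ((-1) ^ r * of_nat (j choose r) *
       pochhammer (x + of_nat r) s * pochhammer (y + of_nat (j - r)) (i - s)))"
    unfolding diff_poch_def sum_distrib_left by (simp add: mult_ac)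
  also have "\<dots> = (\<Sum>s\<le>i. \<Sum>r\<le>j. (-1) ^ r * of_nat (j choose r) *
        pochhammer (x + of_nat r) (i - r) * pochhammer (y + of_nat (j - r)) (i - (j - r)) *
        ((-1) ^ s * of_nat (i choose s) * pochhammer (x + of_nat s) r * pochhammer (y + of_nat (i - s)) (j - r)))"
  proof (intro sum.cong refl)
    fix s r assume "s \<in> {..i}" "r \<in> {..j}"
    then have *: "s \<le> i" "r \<le> i" "i - s \<le> i" "j - r \<le> i" "i - (i - s) = s" using \<open>j < i\<close> by auto
    let ?A = "(-1) ^ s * of_nat (i choose s) * ((-1) ^ r * of_nat (j choose r))"
    have "(-1) ^ s * (fact i * bracket_coeff x y i s) * ((-1) ^ r * of_nat (j choose r) *
       pochhammer (x + of_nat r) s * pochhammer (y + of_nat (j - r)) (i - s)) =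
       ?A * (pochhammer (x + of_nat s) (i - s) * pochhammer (x + of_nat r) s) *
        (pochhammer (y + of_nat (i - s)) (i - (i - s)) * pochhammer (y + of_nat (j - r)) (i - s))"
      \<comment> \<open>The exchange is used at \<open>(r, s)\<close> for \<open>x\<close> and at
        \<open>(j - r, i - s)\<close> for \<open>y\<close>.\<close>
      unfolding bracket_coeff_pochhammer[OF *(1)] *(5) by (simp only: mult_ac)
    also have "\<dots> = ?A * (pochhammer (x + of_nat r) (i - r) * pochhammer (x + of_nat s) r) *
        (pochhammer (y + of_nat (j - r)) (i - (j - r)) * pochhammer (y + of_nat (i - s)) (j - r))"
      unfolding pochhammer_exchange[OF *(2,1)] pochhammer_exchange[OF *(4,3)] ..
    finally show "(-1) ^ s * (fact i * bracket_coeff x y i s) * ((-1) ^ r * of_nat (j choose r) *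
       pochhammer (x + of_nat r) s * pochhammer (y + of_nat (j - r)) (i - s)) =
       (-1) ^ r * of_nat (j choose r) *
        pochhammer (x + of_nat r) (i - r) * pochhammer (y + of_nat (j - r)) (i - (j - r)) *
        ((-1) ^ s * of_nat (i choose s) * pochhammer (x + of_nat s) r * pochhammer (y + of_nat (i - s)) (j - r))"
      by (simp only: mult_ac)
  qed
  also have "\<dots> = (\<Sum>r\<le>j. (-1) ^ r * of_nat (j choose r) *
        pochhammer (x + of_nat r) (i - r) * pochhammer (y + of_nat (j - r)) (i - (j - r)) *
        diff_poch x y i r (j - r))"
    unfolding diff_poch_def sum_distrib_left by (rule sum.swap)
  also have "\<dots> = 0"
    using \<open>j < i\<close> by (intro sum.neutral) (auto simp: diff_poch_eq_0)
  finally show ?thesis by simp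
qed

section \<open>The arrays \<open>c_coeff\<close> and \<open>b_coeff\<close> and their
  inversion\<close>

lemma zbinom_int: "zbinom x (int r) = of_int x gchoose r"
  by (simp add: zbinom_def)

lemma zbinom_nat: "zbinom (int n) (int r) = of_nat (n choose r)"
  by (simp add: zbinom_int binomial_gbinomial)

lemma zbinom_diff: "zbinom x (int a - int b) = (if b \<le> a then of_int x gchoose (a - b) else 0)"
  by (auto simp: zbinom_def nat_diff_distrib)

text \<open>Row \<open>i\<close> consists of the coefficients of (X + Y)^(n-i) P_i, with
  \<open>m\<close> the exponent of Y. The sequence \<open>X\<close> is arbitrary so that it can
  stand for values of M_j as well as for products of derivatives.\<close>

lemma sum_c_coeff:
  assumes "i \<le> n"
  shows "(\<Sum>m\<le>n. c_coeff k l n i m * X m) =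
    (\<Sum>r\<le>i. (-1) ^ r * bracket_coeff (of_int k) (of_int l) i r *
       (\<Sum>t\<le>n - i. of_nat ((n - i) choose t) * X (n - r - t)))"
proof -
  define w where "w m r = (if m + r \<le> n then of_nat ((n - i) choose (n - m - r)) else 0 :: complex)" for m r
  have w: "zbinom (int n - int i) (int n - int m - int r) = w m r" for m r
    using zbinom_diff[of "int (n - i)" n "m + r"] assms
    by (auto simp: w_def algebra_simps of_nat_diff binomial_gbinomial)
  have c: "c_coeff k l n i m = (\<Sum>r\<le>i. w m r * ((-1) ^ r * bracket_coeff (of_int k) (of_int l) i r))" for m
    unfolding c_coeff_def w atLeast0AtMost
    by (intro sum.cong refl) (simp add: zbinom_int zbinom_diff bracket_coeff_def mult_ac)
  have inner: "(\<Sum>m\<le>n. w m r * X m) = (\<Sum>t\<le>n - i. of_nat ((n - i) choose t) * X (n - r - t))"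
    if "r \<le> i" for r
  proof -
    \<comment> \<open>Outside the image the lower binomial entry is negative or exceeds
      \<open>n - i\<close>, so the weight is zero.\<close>
    have "(\<Sum>m\<le>n. w m r * X m) = (\<Sum>m\<in>(\<lambda>t. n - r - t) ` {..n - i}. w m r * X m)"
    proof (rule sum.mono_neutral_right)
      show "\<forall>m\<in>{..n} - (\<lambda>t. n - r - t) ` {..n - i}. w m r * X m = 0"
      proof
        fix m assume m: "m \<in> {..n} - (\<lambda>t. n - r - t) ` {..n - i}"
        show "w m r * X m = 0"
        proof (cases "m + r \<le> n")
          case True
          then have "n - r - (n - m - r) = m" by simp
          then have "\<not> n - m - r \<le> n - i" using m by (metis DiffD2 atMost_iff image_eqI)
          then show ?thesis by (simp add: w_def)
        qed (simp add: w_def)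
      qed
    qed auto
    also have "\<dots> = (\<Sum>t\<le>n - i. w (n - r - t) r * X (n - r - t))"
      using that assms by (subst sum.reindex) (auto simp: inj_on_def)
    also have "\<dots> = (\<Sum>t\<le>n - i. of_nat ((n - i) choose t) * X (n - r - t))"
      using that assms by (intro sum.cong refl) (auto simp: w_def)
    finally show ?thesis .
  qed
  have "(\<Sum>m\<le>n. c_coeff k l n i m * X m) =
    (\<Sum>r\<le>i. (-1) ^ r * bracket_coeff (of_int k) (of_int l) i r * (\<Sum>m\<le>n. w m r * X m))"
    unfolding c sum_distrib_left sum_distrib_right by (subst sum.swap) (simp add: mult_ac)
  then show ?thesis by (simp add: inner)
qed

text \<open>Up to factorials the numerator is the Leibniz expansion of M_j at X^(n-i) Y^i, and the
  new denominator is M_j at (X + Y)^(n-j) P_j.\<close>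

lemma b_coeff_eq:
  fixes k l :: int
  assumes "i \<le> n" "j \<le> n"
  shows "b_coeff k l n i j = diff_poch (of_int k) (of_int l) j (n - i) i /
    (fact j * pochhammer (of_int (k + l) + of_nat (2 * j)) (n - j) *
     ((of_int (k + l) + of_nat (2 * j) - 2) gchoose j))"
proof -
  define T where "T r = (-1) ^ r * of_nat ((n - i) choose r) * of_nat (i choose (j - r)) *
     pochhammer (of_int k + of_nat r :: complex) (n - i - r) *
     pochhammer (of_int l + of_nat (j - r)) (i - (j - r))" for r
  have summand: "of_nat (n choose j) * ((-1) ^ r * zbinom (int j) (int r) *
        zbinom (k + int n - int i - 1) (int n - int i - int r) *
        zbinom (l + int i - 1) (int r + int i - int j)) = of_nat (n choose i) / fact (n - j) * T r"
    if r: "r \<le> j" for r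
  proof (cases "r \<le> n - i \<and> j - r \<le> i")
    \<comment> \<open>Out of range, a natural binomial coefficient in \<open>T\<close> and the
      matching \<open>zbinom\<close> with negative lower entry both vanish.\<close>
    case False
    then have "n - i < r \<or> i < j - r" by auto
    moreover from this have "int n - int i - int r < 0 \<or> int r + int i - int j < 0"
      using r assms by linarith
    ultimately show ?thesis by (auto simp: T_def zbinom_def)
  next
    case True
    then have le: "i + r \<le> n" "j \<le> i + r" using assms by auto
    have 1: "zbinom (k + int n - int i - 1) (int n - int i - int r) =
        pochhammer (of_int k + of_nat r) (n - i - r) / fact (n - i - r)"
    proof -
      have "int n - int i - int r = int (n - i - r)" using le by simp
      moreover have "of_int (k + int n - int i - 1) - of_nat (n - i - r) + 1 = (of_int k + of_nat r :: complex)"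
        using le by (simp add: of_nat_diff)
      ultimately show ?thesis by (simp only: gbinomial_pochhammer' zbinom_int)
    qed
    have 2: "zbinom (l + int i - 1) (int r + int i - int j) =
        pochhammer (of_int l + of_nat (j - r)) (i - (j - r)) / fact (i - (j - r))"
    proof -
      have "int r + int i - int j = int (i - (j - r))" using le r by simp
      moreover have "of_int (l + int i - 1) - of_nat (i - (j - r)) + 1 = (of_int l + of_nat (j - r) :: complex)"
        using le r by (simp add: of_nat_diff)
      ultimately show ?thesis by (simp only: gbinomial_pochhammer' zbinom_int)
    qed
    \<comment> \<open>Both sides are n! divided by (n-j)! r! (j-r)! (n-i-r)! (i-j+r)!.\<close>
    have 3: "of_nat (n choose j) * of_nat (j choose r) / (fact (n - i - r) * fact (i - (j - r))) =
      (of_nat (n choose i) / fact (n - j) * (of_nat ((n - i) choose r) * of_nat (i choose (j - r))) :: complex)"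
    proof -
      have "r \<le> n - i" "j - r \<le> i" using True by auto
      then show ?thesis
        unfolding binomial_fact[OF assms(1)] binomial_fact[OF assms(2)] binomial_fact[OF r]
          binomial_fact[OF \<open>r \<le> n - i\<close>] binomial_fact[OF \<open>j - r \<le> i\<close>]
        by simp
    qed
    have "of_nat (n choose j) * ((-1) ^ r * zbinom (int j) (int r) *
        zbinom (k + int n - int i - 1) (int n - int i - int r) *
        zbinom (l + int i - 1) (int r + int i - int j)) =
      (of_nat (n choose j) * of_nat (j choose r) / (fact (n - i - r) * fact (i - (j - r)))) *
      ((-1) ^ r * pochhammer (of_int k + of_nat r) (n - i - r) *
        pochhammer (of_int l + of_nat (j - r)) (i - (j - r)))"
      unfolding 1 2 zbinom_nat by simp
    then show ?thesis unfolding 3 T_def by (simp add: mult_ac)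
  qed
  have "of_nat (n choose j) * (\<Sum>r=0..j. (-1) ^ r * zbinom (int j) (int r) *
        zbinom (k + int n - int i - 1) (int n - int i - int r) *
        zbinom (l + int i - 1) (int r + int i - int j)) =
      of_nat (n choose i) / fact (n - j) * (\<Sum>r\<le>j. T r)"
    unfolding sum_distrib_left atLeast0AtMost by (intro sum.cong refl summand) simp
  also have "\<dots> = of_nat (n choose i) * diff_poch (of_int k) (of_int l) j (n - i) i / (fact j * fact (n - j))"
    unfolding diff_poch_leibniz T_def by simp
  finally have num: "of_nat (n choose j) * (\<Sum>r=0..j. (-1) ^ r * zbinom (int j) (int r) *
        zbinom (k + int n - int i - 1) (int n - int i - int r) *
        zbinom (l + int i - 1) (int r + int i - int j)) =
      of_nat (n choose i) * diff_poch (of_int k) (of_int l) j (n - i) i / (fact j * fact (n - j))" .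
  have den: "zbinom (k + l + int n + int j - 1) (int n - int j) =
      pochhammer (of_int (k + l) + of_nat (2 * j)) (n - j) / fact (n - j)"
    using assms by (simp add: zbinom_diff gbinomial_pochhammer' of_nat_diff algebra_simps)
  have "of_int (k + l + 2 * int j - 2) = (of_int (k + l) + of_nat (2 * j) - 2 :: complex)" by simp
  then show ?thesis
    unfolding b_coeff_def zbinom_nat[of n i] zbinom_nat[of n j] num den
      zbinom_int[of "k + l + 2 * int j - 2"]
    using assms(1) by (simp only:) simp
qed

lemma sum_c_coeff_b_coeff:
  fixes k l :: int
  assumes "i \<le> n" "j \<le> n" and kl: "k + l \<ge> 2 \<or> k + l + 2 * int n \<le> 0"
  shows "(\<Sum>m\<le>n. c_coeff k l n i m * b_coeff k l n m j) = (if i = j then 1 else 0)"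
proof -
  define x y where "x = (of_int k :: complex)" and "y = (of_int l :: complex)"
  define P where "P = pochhammer (x + y + of_nat (2 * j)) (n - j)"
  define G where "G = (x + y + of_nat (2 * j) - 2) gchoose j"
  \<comment> \<open>Each linear factor of \<open>P\<close>, and of the numerator of
    \<open>G\<close>, is k + l + s with 0 <= s < 2n: positive in the first case of
    \<open>kl\<close>, negative in the second.\<close>
  have "P \<noteq> 0"
  proof
    assume "P = 0"
    then obtain q where q: "q < n - j" "x + y + of_nat (2 * j) = - of_nat q"
      unfolding P_def pochhammer_eq_0_iff by blast
    then have "of_int (k + l + 2 * int j + int q) = (0 :: complex)"
      by (simp add: x_def y_def add_eq_0_iff2)
    then show False using q(1) kl assms by (simp only: of_int_eq_0_iff) linarith
  qed
  have "G \<noteq> 0"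
  proof
    assume "G = 0"
    then have "pochhammer (x + y + of_nat j - 1) j = 0"
      unfolding G_def gbinomial_pochhammer' by (simp add: algebra_simps)
    then obtain q where q: "q < j" "x + y + of_nat j - 1 = - of_nat q"
      unfolding pochhammer_eq_0_iff by blast
    then have "of_int (k + l + int j - 1 + int q) = (0 :: complex)"
      by (simp add: x_def y_def add_eq_0_iff2)
    then show False using q(1) kl assms by (simp only: of_int_eq_0_iff) linarith
  qed
  have b: "b_coeff k l n m j = diff_poch x y j (n - m) m / (fact j * P * G)" if "m \<le> n" for m
    using b_coeff_eq[OF that assms(2), of k l] by (simp add: x_def y_def P_def G_def)
  have "(\<Sum>m\<le>n. c_coeff k l n i m * diff_poch x y j (n - m) m) =
      (\<Sum>r\<le>i. (-1) ^ r * bracket_coeff x y i r *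
        (\<Sum>t\<le>n - i. of_nat ((n - i) choose t) * diff_poch x y j (r + t) (i - r + (n - i - t))))"
    unfolding sum_c_coeff[OF assms(1)] x_def y_def
    using assms(1) by (intro sum.cong refl arg_cong2[where f = "(*)"] arg_cong2[where f = "diff_poch _ _ j"]) auto
  \<comment> \<open>Since r + (i - r) = i, the scaling factor is the same for all
    \<open>r\<close>.\<close>
  also have "\<dots> = (\<Sum>r\<le>i. (-1) ^ r * bracket_coeff x y i r *
      (pochhammer (x + y + of_nat (j + i)) (n - i) * diff_poch x y j r (i - r)))"
    unfolding diff_poch_binomial_sum by (intro sum.cong refl) (simp del: of_nat_add of_nat_diff)
  also have "\<dots> = pochhammer (x + y + of_nat (j + i)) (n - i) *
      (\<Sum>r\<le>i. (-1) ^ r * bracket_coeff x y i r * diff_poch x y j r (i - r))"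
    by (simp add: sum_distrib_left mult_ac)
  also have "\<dots> = (if i = j then fact j * P * G else 0)"
  proof (cases "i = j")
    case True
    then show ?thesis
      unfolding True bracket_coeff_diff_poch_diag by (simp only: P_def G_def mult_2[symmetric] if_True mult_ac)
  next
    case False
    then show ?thesis
      unfolding bracket_coeff_diff_poch_off_diag[OF False] by simp
  qed
  finally have "(\<Sum>m\<le>n. c_coeff k l n i m * diff_poch x y j (n - m) m) =
      (if i = j then fact j * P * G else 0)" .
  moreover have "(\<Sum>m\<le>n. c_coeff k l n i m * b_coeff k l n m j) =
      (\<Sum>m\<le>n. c_coeff k l n i m * diff_poch x y j (n - m) m) / (fact j * P * G)"
    unfolding sum_divide_distrib by (intro sum.cong refl) (simp add: b)
  ultimately show ?thesis
    using \<open>P \<noteq> 0\<close> \<open>G \<noteq> 0\<close> by simp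
qed

text \<open>A one-sided inverse of a square matrix over a field is two-sided; this gives b c = 1
  from c b = 1 without a second summation.\<close>

lemma sum_right_inverse_imp_left_inverse:
  fixes A B :: "nat \<Rightarrow> nat \<Rightarrow> 'a::field"
  assumes "\<And>i j. i < n \<Longrightarrow> j < n \<Longrightarrow> (\<Sum>m<n. A i m * B m j) = (if i = j then 1 else 0)"
    and "i < n" "j < n"
  shows "(\<Sum>m<n. B i m * A m j) = (if i = j then 1 else 0)"
proof -
  let ?M = "\<lambda>C. mat n n (\<lambda>(i, j). C i j :: 'a)"
  have "?M A * ?M B = 1\<^sub>m n"
    by (intro eq_matI) (simp_all add: scalar_prod_def atLeast0LessThan assms(1))
  then have "?M B * ?M A = 1\<^sub>m n"
    by (rule mat_mult_left_right_inverse[OF mat_carrier mat_carrier])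
  then have "(?M B * ?M A) $$ (i, j) = 1\<^sub>m n $$ (i, j)" by simp
  then show ?thesis using assms(2,3) by (simp add: scalar_prod_def atLeast0LessThan)
qed

lemma sum_b_coeff_c_coeff:
  fixes k l :: int
  assumes "k + l \<ge> 2 \<or> k + l + 2 * int n \<le> 0" "i \<le> n" "j \<le> n"
  shows "(\<Sum>m\<le>n. b_coeff k l n i m * c_coeff k l n m j) = (if i = j then 1 else 0)"
proof -
  have "(\<Sum>m<Suc n. b_coeff k l n i m * c_coeff k l n m j) = (if i = j then 1 else 0)"
  proof (rule sum_right_inverse_imp_left_inverse)
    fix i j assume "i < Suc n" "j < Suc n"
    then show "(\<Sum>m<Suc n. c_coeff k l n i m * b_coeff k l n m j) = (if i = j then 1 else 0)"
      unfolding lessThan_Suc_atMost less_Suc_eq_le by (rule sum_c_coeff_b_coeff[OF _ _ assms(1)])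
  qed (use assms(2,3) in auto)
  then show ?thesis by (simp only: lessThan_Suc_atMost)
qed

section \<open>Iterated derivatives of holomorphic functions and of the bracket\<close>

lemma holomorphic_on_D_funpow:
  assumes "open S" "f holomorphic_on S"
  shows "(D ^^ m) f holomorphic_on S"
proof (induction m)
  case (Suc m)
  then show ?case using assms(1) by (auto simp: D_def intro!: holomorphic_intros)
qed (use assms in simp)

text \<open>\<open>D\<close> depends only on germs, so an identity known just on an open set can
  still be differentiated in the inductions below.\<close>

lemma D_cong:
  assumes "open S" "\<And>z. z \<in> S \<Longrightarrow> f z = g z" "z \<in> S"
  shows "D f z = D g z"
proof -
  have "deriv f z = deriv g z"
    by (intro deriv_cong_ev refl eventually_nhds_in_open[THEN eventually_mono])
       (use assms in auto)
  then show ?thesis by (simp add: D_def)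
qed

lemma D_funpow_sum:
  assumes "open S" "\<And>j. j \<in> A \<Longrightarrow> F j holomorphic_on S" "z \<in> S"
  shows "(D ^^ m) (\<lambda>z. \<Sum>j\<in>A. c j * F j z) z = (\<Sum>j\<in>A. c j * (D ^^ m) (F j) z)"
  using assms(3)
proof (induction m arbitrary: z)
  case (Suc m)
  have "((D ^^ m) (F j) has_field_derivative deriv ((D ^^ m) (F j)) z) (at z)" if "j \<in> A" for j
    using holomorphic_derivI[OF holomorphic_on_D_funpow[OF assms(1) assms(2)[OF that]] assms(1) Suc.prems] .
  then have deriv: "deriv (\<lambda>z. \<Sum>j\<in>A. c j * (D ^^ m) (F j) z) z =
      (\<Sum>j\<in>A. c j * deriv ((D ^^ m) (F j)) z)"
    by (intro DERIV_imp_deriv DERIV_sum DERIV_cmult)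
  have "(D ^^ Suc m) (\<lambda>z. \<Sum>j\<in>A. c j * F j z) z = D (\<lambda>z. \<Sum>j\<in>A. c j * (D ^^ m) (F j) z) z"
    using D_cong[OF assms(1) Suc.IH Suc.prems] by simp
  also have "\<dots> = (\<Sum>j\<in>A. c j * D ((D ^^ m) (F j)) z)"
    unfolding D_def deriv by (simp add: sum_distrib_left mult_ac)
  finally show ?case by simp
qed simp

lemma D_funpow_mult:
  assumes "open S" "u holomorphic_on S" "v holomorphic_on S" "z \<in> S"
  shows "(D ^^ m) (\<lambda>z. u z * v z) z =
    (\<Sum>t\<le>m. of_nat (m choose t) * ((D ^^ t) u z * (D ^^ (m - t)) v z))"
  using assms(4)
proof (induction m arbitrary: z)
  case (Suc m)
  define F where "F t = (D ^^ t) u z * (D ^^ (Suc m - t)) v z" for t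
  have hol: "(D ^^ t) u holomorphic_on S" "(D ^^ t) v holomorphic_on S" for t
    by (intro holomorphic_on_D_funpow assms)+
  have diff: "(D ^^ t) u field_differentiable (at z)" "(D ^^ t) v field_differentiable (at z)" for t
    using hol assms(1) Suc.prems by (auto intro: holomorphic_on_imp_differentiable_at)
  have prod: "D (\<lambda>z. (D ^^ t) u z * (D ^^ (m - t)) v z) z = F t + F (Suc t)" if "t \<le> m" for t
    using diff[of t] diff[of "m - t"] that
    by (simp add: F_def D_def Suc_diff_le algebra_simps add_divide_distrib)
  have "(D ^^ Suc m) (\<lambda>z. u z * v z) z =
      D (\<lambda>z. \<Sum>t\<le>m. of_nat (m choose t) * ((D ^^ t) u z * (D ^^ (m - t)) v z)) z"
    using D_cong[OF assms(1) Suc.IH Suc.prems] by simp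
  also have "\<dots> = (\<Sum>t\<le>m. of_nat (m choose t) * D (\<lambda>z. (D ^^ t) u z * (D ^^ (m - t)) v z) z)"
    using D_funpow_sum[OF assms(1) _ Suc.prems, of "{..m}"
        "\<lambda>t z. (D ^^ t) u z * (D ^^ (m - t)) v z" 1 "\<lambda>t. of_nat (m choose t)"]
    by (simp add: holomorphic_on_mult hol)
  also have "\<dots> = (\<Sum>t\<le>m. of_nat (m choose t) * F t) + (\<Sum>t\<le>m. of_nat (m choose t) * F (Suc t))"
    unfolding sum.distrib[symmetric] by (intro sum.cong refl) (simp add: prod distrib_left)
  finally show ?case unfolding F_def by (simp only: sum_binomial_Suc)
qed simp

text \<open>The Leibniz rule realises multiplication by (X + Y)^(n-i). The sign (-1)^i is what
  remains when the bracket, summed over derivatives of \<open>g\<close>, is matched with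
  P_i.\<close>

lemma D_funpow_rankin_cohen:
  assumes "open S" "f holomorphic_on S" "g holomorphic_on S" "z \<in> S" "i \<le> n"
  shows "(-1) ^ i * (D ^^ (n - i)) (rankin_cohen k l i f g) z =
    (\<Sum>m\<le>n. c_coeff k l n i m * ((D ^^ (n - m)) f z * (D ^^ m) g z))"
proof -
  have hol: "(D ^^ t) f holomorphic_on S" "(D ^^ t) g holomorphic_on S" for t
    by (intro holomorphic_on_D_funpow assms)+
  have fold_D: "(D ^^ t) ((D ^^ m) h) = (D ^^ (m + t)) h" for t m h
    by (simp add: funpow_add add.commute[of m])
  define a :: "nat \<Rightarrow> complex" where
    "a j = (-1) ^ j * bracket_coeff (of_int k) (of_int l) i (i - j)" for j
  have "rankin_cohen k l i f g = (\<lambda>z. \<Sum>j\<le>i. a j * ((D ^^ (i - j)) f z * (D ^^ j) g z))"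
    unfolding rankin_cohen_def a_def atLeast0AtMost
    by (intro ext sum.cong refl) (simp add: zbinom_int zbinom_diff bracket_coeff_def algebra_simps)
  then have "(D ^^ (n - i)) (rankin_cohen k l i f g) z =
      (\<Sum>j\<le>i. a j * (D ^^ (n - i)) (\<lambda>z. (D ^^ (i - j)) f z * (D ^^ j) g z) z)"
    using D_funpow_sum[OF assms(1) _ assms(4), of "{..i}"
        "\<lambda>j z. (D ^^ (i - j)) f z * (D ^^ j) g z" "n - i" a]
    by (simp add: holomorphic_on_mult hol)
  also have "\<dots> = (\<Sum>j\<le>i. a j * (\<Sum>t\<le>n - i. of_nat ((n - i) choose t) *
      ((D ^^ (i - j + t)) f z * (D ^^ (j + (n - i - t))) g z)))"
    by (simp only: D_funpow_mult[OF assms(1) hol assms(4)] fold_D)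
  \<comment> \<open>Reversing the sum by j = i - r passes to the indexing of
    \<open>sum_c_coeff\<close>.\<close>
  also have "\<dots> = (\<Sum>r\<le>i. a (i - r) * (\<Sum>t\<le>n - i. of_nat ((n - i) choose t) *
      ((D ^^ (i - (i - r) + t)) f z * (D ^^ (i - r + (n - i - t))) g z)))"
    by (rule sum.nat_diff_reindex[symmetric, of _ "Suc i", simplified lessThan_Suc_atMost, simplified])
  finally have "(-1) ^ i * (D ^^ (n - i)) (rankin_cohen k l i f g) z =
      (\<Sum>r\<le>i. (-1) ^ i * (a (i - r) * (\<Sum>t\<le>n - i. of_nat ((n - i) choose t) *
      ((D ^^ (i - (i - r) + t)) f z * (D ^^ (i - r + (n - i - t))) g z))))"
    by (simp only: sum_distrib_left[of "(-1) ^ i"])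
  also have "\<dots> = (\<Sum>r\<le>i. (-1) ^ r * bracket_coeff (of_int k) (of_int l) i r *
      (\<Sum>t\<le>n - i. of_nat ((n - i) choose t) *
        ((D ^^ (n - (n - r - t))) f z * (D ^^ (n - r - t)) g z)))"
  proof (rule sum.cong)
    fix r assume "r \<in> {..i}"
    then have r: "r \<le> i" by simp
    have sgn: "(-1) ^ i * a (i - r) = (-1) ^ r * bracket_coeff (of_int k) (of_int l) i r"
      using r by (auto simp: a_def minus_one_power_iff)
    have "(\<Sum>t\<le>n - i. of_nat ((n - i) choose t) *
        ((D ^^ (i - (i - r) + t)) f z * (D ^^ (i - r + (n - i - t))) g z)) =
      (\<Sum>t\<le>n - i. of_nat ((n - i) choose t) *
        ((D ^^ (n - (n - r - t))) f z * (D ^^ (n - r - t)) g z))"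
    proof (rule sum.cong)
      fix t assume "t \<in> {..n - i}"
      then have "i - (i - r) + t = n - (n - r - t)" "i - r + (n - i - t) = n - r - t"
        using r assms(5) by auto
      then show "of_nat ((n - i) choose t) *
          ((D ^^ (i - (i - r) + t)) f z * (D ^^ (i - r + (n - i - t))) g z) =
        of_nat ((n - i) choose t) *
          ((D ^^ (n - (n - r - t))) f z * (D ^^ (n - r - t)) g z)" by (simp only:)
    qed simp
    then show "(-1) ^ i * (a (i - r) * (\<Sum>t\<le>n - i. of_nat ((n - i) choose t) *
        ((D ^^ (i - (i - r) + t)) f z * (D ^^ (i - r + (n - i - t))) g z))) =
      (-1) ^ r * bracket_coeff (of_int k) (of_int l) i r * (\<Sum>t\<le>n - i. of_nat ((n - i) choose t) *
        ((D ^^ (n - (n - r - t))) f z * (D ^^ (n - r - t)) g z))"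
      by (simp only: sgn mult.assoc[symmetric])
  qed simp
  also have "\<dots> = (\<Sum>m\<le>n. c_coeff k l n i m * ((D ^^ (n - m)) f z * (D ^^ m) g z))"
    by (rule sum_c_coeff[OF assms(5), symmetric])
  finally show ?thesis .
qed

section \<open>Both expansions at a common regular point\<close>

theorem theorem5p6:
  fixes f g :: "complex \<Rightarrow> complex" and k l :: int and n :: nat
  assumes "meromorphic_modular_form k f"
    and "meromorphic_modular_form l g"
    and "n > 0"
    and "k + l \<ge> 2 \<or> k + l + 2 * int n \<le> 0"
  shows "\<forall>i\<le>n. \<forall>\<tau>\<in>upper_half_plane. \<not> is_pole f \<tau> \<longrightarrow> \<not> is_pole g \<tau> \<longrightarrow>
      (- 1) ^ i * (D ^^ (n - i)) (rankin_cohen k l i f g) \<tau> =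
        (\<Sum>j=0..n. c_coeff k l n i j * ((D ^^ (n - j)) f \<tau> * (D ^^ j) g \<tau>)) \<and>
      (D ^^ (n - i)) f \<tau> * (D ^^ i) g \<tau> =
        (\<Sum>j=0..n. b_coeff k l n i j * ((- 1) ^ j * (D ^^ (n - j)) (rankin_cohen k l j f g) \<tau>))"
proof (intro allI impI ballI)
  fix i \<tau> assume i: "i \<le> n" and \<tau>: "\<tau> \<in> upper_half_plane" "\<not> is_pole f \<tau>" "\<not> is_pole g \<tau>"
  \<comment> \<open>The normalised representative is analytic wherever it has no pole, so all
    derivatives can be taken on a common neighbourhood.\<close>
  have "f analytic_on {\<tau>}" "g analytic_on {\<tau>}"
    using assms(1,2) \<tau> unfolding meromorphic_modular_form_def
    by (auto intro: nicely_meromorphic_on_imp_analytic_at)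
  then obtain U V where UV: "open U" "\<tau> \<in> U" "f holomorphic_on U" "open V" "\<tau> \<in> V" "g holomorphic_on V"
    unfolding analytic_at by blast
  define X where "X m = (D ^^ (n - m)) f \<tau> * (D ^^ m) g \<tau>" for m
  have bracket: "(-1) ^ j * (D ^^ (n - j)) (rankin_cohen k l j f g) \<tau> = (\<Sum>m\<le>n. c_coeff k l n j m * X m)"
    if "j \<le> n" for j
    unfolding X_def using UV that
    by (intro D_funpow_rankin_cohen[of "U \<inter> V"]) (auto elim: holomorphic_on_subset)
  \<comment> \<open>Inserting the first expansion and swapping the sums produces the product matrix
    b c, which is the identity.\<close>
  have "(\<Sum>j\<le>n. b_coeff k l n i j * ((-1) ^ j * (D ^^ (n - j)) (rankin_cohen k l j f g) \<tau>)) =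
      (\<Sum>j\<le>n. \<Sum>m\<le>n. b_coeff k l n i j * c_coeff k l n j m * X m)"
    by (simp add: bracket sum_distrib_left mult_ac)
  also have "\<dots> = (\<Sum>m\<le>n. (\<Sum>j\<le>n. b_coeff k l n i j * c_coeff k l n j m) * X m)"
    by (subst sum.swap) (simp add: sum_distrib_right)
  also have "\<dots> = (\<Sum>m\<le>n. if m = i then X m else 0)"
    using i by (intro sum.cong refl) (simp add: sum_b_coeff_c_coeff[OF assms(4)])
  also have "\<dots> = X i"
    using i by simp
  finally show "(- 1) ^ i * (D ^^ (n - i)) (rankin_cohen k l i f g) \<tau> =
        (\<Sum>j=0..n. c_coeff k l n i j * ((D ^^ (n - j)) f \<tau> * (D ^^ j) g \<tau>)) \<and>
      (D ^^ (n - i)) f \<tau> * (D ^^ i) g \<tau> =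
        (\<Sum>j=0..n. b_coeff k l n i j * ((- 1) ^ j * (D ^^ (n - j)) (rankin_cohen k l j f g) \<tau>))"
    using bracket[OF i] by (simp only: X_def atLeast0AtMost)
qed

end
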